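(* Fix $\lambda_t,\lambda_s>0$, a teacher ridge coefficient $\beta_{\lambda_t}\in\mathbb R^p$, and a fresh unlabeled design $\tilde X\in\mathbb R^{n_s\times p}$. Let $$\beta_{\mathrm{pd},\lambda_s}:=(\tilde X^\top\tilde X/n_s+\lambda_sI_p)^{-1}(\tilde X^\top\tilde X/n_s)\beta_{\lambda_t},\qquad \delta:=\beta_{\lambda_t}-\beta_{\mathrm{pd},\lambda_s},$$ and assume $\|\delta\|_\Sigma^2>0$. For any $\eta\in\mathbb R$, define a test model by $$x_0\sim P_x\ \text{with}\ \mathbb E[x_0x_0^\top]=\Sigma,\qquad y_0=x_0^\top\beta_\eta+\varepsilon_0,\qquad \beta_\eta:=\beta_{\lambda_t}-\eta\,\delta,$$ where $\varepsilon_0$ is independent of $x_0$ with mean $0$ and variance $\sigma^2$. Then, even if $\Sigma$ is known, the observable pair $(\beta_{\lambda_t},\tilde X)$ is the same for every $\eta$, whereas $$\xi^\star_\eta(\lambda_t,\lambda_s)=\eta,\qquad R^\star_{\mathsf{pmsd},\eta}=\sigma^2.$$ In particular, $\xi^\star(\lambda_t,\lambda_s)$ is not identifiable from $(\beta_{\lambda_t},\tilde X)$: no function of $(\beta_{\lambda_t},\tilde X)$ (and $\Sigma$) equals $\xi^\star_\eta(\lambda_t,\lambda_s)$ for all $\eta$.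
   Context: $\Sigma\in\mathbb R^{p\times p}$ is positive definite and $\|u\|_\Sigma^2=u^\top\Sigma u$. For $\xi\in\mathbb R$ the prediction-mixed (PMSD) predictor is $x\mapsto x^\top\big((1-\xi)\beta_{\lambda_t}+\xi\beta_{\mathrm{pd},\lambda_s}\big)$. In the test model indexed by $\eta$, its squared prediction risk is $R_{\mathsf{pmsd},\eta}(\xi)=\mathbb E\big[(y_0-x_0^\top((1-\xi)\beta_{\lambda_t}+\xi\beta_{\mathrm{pd},\lambda_s}))^2\big]$, where $\beta_{\lambda_t}$ and $\tilde X$ are fixed; $\xi^\star_\eta(\lambda_t,\lambda_s)=\arg\min_{\xi\in\mathbb R}R_{\mathsf{pmsd},\eta}(\xi)$ is the oracle mixing weight and $R^\star_{\mathsf{pmsd},\eta}=\min_{\xi\in\mathbb R}R_{\mathsf{pmsd},\eta}(\xi)$. *)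

theory Defs
  imports "HOL-Probability.Probability"
begin

text \<open>
  \<^typ>\<open>real^'p^'p\<close> matrices act on \<^typ>\<open>real^'p\<close>; a design with \<open>n\<close> rows is a
  \<^typ>\<open>real^'p^'n\<close> matrix, with \<open>n = CARD('n)\<close>.
\<close>

definition positive_definite :: "real^'p^'p \<Rightarrow> bool" where
  "positive_definite A \<longleftrightarrow> transpose A = A \<and> (\<forall>u. u \<noteq> 0 \<longrightarrow> u \<bullet> (A *v u) > 0)"

definition sq_norm_wrt :: "real^'p^'p \<Rightarrow> real^'p \<Rightarrow> real" where
  "sq_norm_wrt A u = u \<bullet> (A *v u)"

definition sample_cov :: "real^'p^'n \<Rightarrow> real^'p^'p" where
  "sample_cov X = (1 / real CARD('n)) *\<^sub>R (transpose X ** X)"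

text \<open>The pure-distillation coefficient: ridge regression on \<open>X\<close> with pseudo-labels \<open>X \<beta>\<close>.\<close>

definition pd_coeff :: "real \<Rightarrow> real^'p^'n \<Rightarrow> real^'p \<Rightarrow> real^'p" where
  "pd_coeff lam\<^sub>s X \<beta> =
     matrix_inv (sample_cov X + lam\<^sub>s *\<^sub>R mat 1) *v (sample_cov X *v \<beta>)"

definition pd_gap :: "real \<Rightarrow> real^'p^'n \<Rightarrow> real^'p \<Rightarrow> real^'p" where
  "pd_gap lam\<^sub>s X \<beta> = \<beta> - pd_coeff lam\<^sub>s X \<beta>"

definition outer_square :: "real^'p \<Rightarrow> real^'p^'p" where
  "outer_square x = (\<chi> i j. x $ i * x $ j)"

text \<open>
  Independence of two random variables with possibly different value types
  (\<^const>\<open>prob_space.indep_var\<close> needs a common type): the generated sigma algebras are independent.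
\<close>

definition indep_rvs :: "'a measure \<Rightarrow> 'b measure \<Rightarrow> ('a \<Rightarrow> 'b) \<Rightarrow> 'c measure \<Rightarrow> ('a \<Rightarrow> 'c) \<Rightarrow> bool" where
  "indep_rvs M S X T Y \<longleftrightarrow>
     X \<in> measurable M S \<and> Y \<in> measurable M T \<and>
     prob_space.indep_set M
       (sigma_sets (space M) {X -` A \<inter> space M | A. A \<in> sets S})
       (sigma_sets (space M) {Y -` A \<inter> space M | A. A \<in> sets T})"

definition test_covariate ::
    "(real^'p) measure \<Rightarrow> real^'p^'p \<Rightarrow> 'a measure \<Rightarrow> ('a \<Rightarrow> real^'p) \<Rightarrow> bool" where
  "test_covariate P\<^sub>x \<Sigma> M x\<^sub>0 \<longleftrightarrow>
     x\<^sub>0 \<in> borel_measurable M \<and> distr M borel x\<^sub>0 = P\<^sub>x \<and>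
     integrable M (\<lambda>\<omega>. outer_square (x\<^sub>0 \<omega>)) \<and>
     (\<integral>\<omega>. outer_square (x\<^sub>0 \<omega>) \<partial>M) = \<Sigma>"

definition test_noise ::
    "real \<Rightarrow> 'a measure \<Rightarrow> ('a \<Rightarrow> real^'p) \<Rightarrow> ('a \<Rightarrow> real) \<Rightarrow> bool" where
  "test_noise \<sigma> M x\<^sub>0 \<epsilon>\<^sub>0 \<longleftrightarrow>
     indep_rvs M borel x\<^sub>0 borel \<epsilon>\<^sub>0 \<and>
     integrable M (\<lambda>\<omega>. (\<epsilon>\<^sub>0 \<omega>)\<^sup>2) \<and>
     prob_space.expectation M \<epsilon>\<^sub>0 = 0 \<and>
     prob_space.variance M \<epsilon>\<^sub>0 = \<sigma>\<^sup>2"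

text \<open>
  A model consists of the (fixed) teacher coefficient, the (fixed) unlabeled design and the
  distribution of a test pair, of which only the first two are observed.
\<close>

record ('a, 'n::finite, 'p::finite) pmsd_model =
  teacher :: "real^'p"
  design :: "real^'p^'n"
  test_space :: "'a measure"
  test_x :: "'a \<Rightarrow> real^'p"
  test_y :: "'a \<Rightarrow> real"

definition observables :: "('a, 'n::finite, 'p::finite) pmsd_model \<Rightarrow> (real^'p) \<times> (real^'p^'n)" where
  "observables E = (teacher E, design E)"

definition second_moment :: "('a, 'n::finite, 'p::finite) pmsd_model \<Rightarrow> real^'p^'p" where
  "second_moment E = (\<integral>\<omega>. outer_square (test_x E \<omega>) \<partial>test_space E)"

definition shifted_model ::
    "real \<Rightarrow> real^'p \<Rightarrow> real^'p^'n \<Rightarrow> 'a measure \<Rightarrow> ('a \<Rightarrow> real^'p) \<Rightarrow> ('a \<Rightarrow> real) \<Rightarrow> real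
      \<Rightarrow> ('a, 'n::finite, 'p::finite) pmsd_model" where
  "shifted_model lam\<^sub>s \<beta> X M x\<^sub>0 \<epsilon>\<^sub>0 \<eta> =
     \<lparr>teacher = \<beta>, design = X, test_space = M, test_x = x\<^sub>0,
      test_y = (\<lambda>\<omega>. x\<^sub>0 \<omega> \<bullet> (\<beta> - \<eta> *\<^sub>R pd_gap lam\<^sub>s X \<beta>) + \<epsilon>\<^sub>0 \<omega>)\<rparr>"

definition pmsd_predictor :: "real \<Rightarrow> real^'p^'n \<Rightarrow> real^'p \<Rightarrow> real \<Rightarrow> real^'p \<Rightarrow> real" where
  "pmsd_predictor lam\<^sub>s X \<beta> \<xi> x = x \<bullet> ((1 - \<xi>) *\<^sub>R \<beta> + \<xi> *\<^sub>R pd_coeff lam\<^sub>s X \<beta>)"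

definition pmsd_risk :: "real \<Rightarrow> ('a, 'n::finite, 'p::finite) pmsd_model \<Rightarrow> real \<Rightarrow> real" where
  "pmsd_risk lam\<^sub>s E \<xi> =
     (\<integral>\<omega>. (test_y E \<omega> - pmsd_predictor lam\<^sub>s (design E) (teacher E) \<xi> (test_x E \<omega>))\<^sup>2 \<partial>test_space E)"

definition oracle_weight :: "real \<Rightarrow> ('a, 'n::finite, 'p::finite) pmsd_model \<Rightarrow> real" where
  "oracle_weight lam\<^sub>s E = arg_min (pmsd_risk lam\<^sub>s E) (\<lambda>_. True)"

text \<open>On a set without a minimum \<^const>\<open>Least\<close> is unspecified; so it is not an infimum.\<close>

definition oracle_risk :: "real \<Rightarrow> ('a, 'n::finite, 'p::finite) pmsd_model \<Rightarrow> real" where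
  "oracle_risk lam\<^sub>s E = (LEAST r. r \<in> range (pmsd_risk lam\<^sub>s E))"

end

theory Submission
  imports Defs
begin

text \<open>
  The proof rests on one observation: since \<open>\<beta>\<^sub>\<eta> = \<beta> - \<eta> \<delta>\<close> and the mixed coefficient is
  \<open>(1 - \<xi>) \<beta> + \<xi> (\<beta> - \<delta>) = \<beta> - \<xi> \<delta>\<close>, both lie on the line through \<open>\<beta>\<close> with direction
  \<open>\<delta>\<close>, and the prediction error is \<open>(\<xi> - \<eta>) (x\<^sub>0 \<bullet> \<delta>) + \<epsilon>\<^sub>0\<close>.  Squaring and integrating, the
  cross term vanishes because the noise is centred and independent of \<open>x\<^sub>0\<close>, and what remains
  is the parabola \<open>\<sigma>\<^sup>2 + (\<xi> - \<eta>)\<^sup>2 \<parallel>\<delta>\<parallel>\<^sub>\<Sigma>\<^sup>2\<close> (lemma \<open>pmsd_risk_shifted_model\<close>).  As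
  \<open>\<parallel>\<delta>\<parallel>\<^sub>\<Sigma>\<^sup>2 > 0\<close>, its only minimiser is \<open>\<eta>\<close> and its minimum is \<open>\<sigma>\<^sup>2\<close>.
  But the teacher, the design and the covariate second moment \<open>\<Sigma>\<close> are the same in all the
  models, since the shift \<open>\<eta>\<close> moves only the regression function of the label; hence a function
  of these data is constant in \<open>\<eta>\<close> and cannot return every real number.
\<close>

lemma quadratic_form_outer_square: "sq_norm_wrt (outer_square x) u = (x \<bullet> u)\<^sup>2"
  by (simp add: sq_norm_wrt_def outer_square_def matrix_vector_mult_def inner_vec_def
      power2_eq_square sum_product sum_distrib_left algebra_simps)

lemma bounded_linear_sq_norm_wrt: "bounded_linear (\<lambda>A. sq_norm_wrt A u)"
  unfolding sq_norm_wrt_def linear_conv_bounded_linear[symmetric]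
  by (rule linearI)
    (simp_all add: matrix_vector_mult_add_rdistrib inner_add_right scaleR_matrix_vector_assoc[symmetric])

text \<open>The quadratic form of a fixed vector is linear in the matrix and hence commutes with the
  integral.\<close>

lemma
  assumes "integrable M (\<lambda>\<omega>. outer_square (x \<omega>))"
  shows integrable_inner_square: "integrable M (\<lambda>\<omega>. (x \<omega> \<bullet> u)\<^sup>2)"
    and integral_inner_square:
      "(\<integral>\<omega>. (x \<omega> \<bullet> u)\<^sup>2 \<partial>M) = sq_norm_wrt (\<integral>\<omega>. outer_square (x \<omega>) \<partial>M) u"
  using integrable_bounded_linear[OF bounded_linear_sq_norm_wrt assms, of u]
    integral_bounded_linear[OF bounded_linear_sq_norm_wrt assms, of u]
  by (simp_all add: quadratic_form_outer_square)

text \<open>A measurable function of the first variable generates a smaller sigma algebra, and so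
  inherits independence; moreover the codomains then agree, so that independence takes its usual form.\<close>

lemma (in prob_space) indep_var_of_indep_rvs:
  assumes ind: "indep_rvs M S X T Y" and f: "f \<in> measurable S T"
  shows "indep_var T (\<lambda>\<omega>. f (X \<omega>)) T Y"
proof -
  have X: "X \<in> measurable M S" and Y: "Y \<in> measurable M T"
    and ind': "indep_set (sigma_sets (space M) {X -` A \<inter> space M | A. A \<in> sets S})
       (sigma_sets (space M) {Y -` A \<inter> space M | A. A \<in> sets T})"
    using ind by (auto simp: indep_rvs_def)
  have "{(\<lambda>\<omega>. f (X \<omega>)) -` A \<inter> space M | A. A \<in> sets T} \<subseteq> {X -` A \<inter> space M | A. A \<in> sets S}"
  proof safe
    fix A assume "A \<in> sets T"
    moreover have "(\<lambda>\<omega>. f (X \<omega>)) -` A \<inter> space M = X -` (f -` A \<inter> space S) \<inter> space M"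
      using measurable_space[OF X] by auto
    ultimately show "\<exists>B. (\<lambda>\<omega>. f (X \<omega>)) -` A \<inter> space M = X -` B \<inter> space M \<and> B \<in> sets S"
      using measurable_sets[OF f] by blast
  qed
  then have sub: "sigma_sets (space M) {(\<lambda>\<omega>. f (X \<omega>)) -` A \<inter> space M | A. A \<in> sets T}
      \<subseteq> sigma_sets (space M) {X -` A \<inter> space M | A. A \<in> sets S}"
    by (rule sigma_sets_mono')
  have "indep_set (sigma_sets (space M) {(\<lambda>\<omega>. f (X \<omega>)) -` A \<inter> space M | A. A \<in> sets T})
       (sigma_sets (space M) {Y -` A \<inter> space M | A. A \<in> sets T})"
    using ind' unfolding indep_set_def
    by (rule indep_sets_mono_sets) (use sub in \<open>auto split: bool.split\<close>)
  then show ?thesis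
    using measurable_compose[OF X f] Y by (simp add: indep_var_eq)
qed

lemma (in prob_space) expectation_square_centered_noise:
  fixes Z \<epsilon> :: "'a \<Rightarrow> real"
  assumes Z: "Z \<in> borel_measurable M" "integrable M (\<lambda>\<omega>. (Z \<omega>)\<^sup>2)"
    and e: "\<epsilon> \<in> borel_measurable M" "integrable M (\<lambda>\<omega>. (\<epsilon> \<omega>)\<^sup>2)" "expectation \<epsilon> = 0"
    and ind: "indep_var borel Z borel \<epsilon>"
  shows "expectation (\<lambda>\<omega>. (c * Z \<omega> + \<epsilon> \<omega>)\<^sup>2) = c\<^sup>2 * expectation (\<lambda>\<omega>. (Z \<omega>)\<^sup>2) + variance \<epsilon>"
proof -
  have iZ: "integrable M Z" and ie: "integrable M \<epsilon>"
    using Z e by (auto intro: square_integrable_imp_integrable)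
  have cross: "integrable M (\<lambda>\<omega>. Z \<omega> * \<epsilon> \<omega>)" "expectation (\<lambda>\<omega>. Z \<omega> * \<epsilon> \<omega>) = 0"
    using indep_var_integrable[OF ind iZ ie] indep_var_lebesgue_integral[OF ind iZ ie] e(3)
    by simp_all
  have "expectation (\<lambda>\<omega>. (c * Z \<omega> + \<epsilon> \<omega>)\<^sup>2)
      = expectation (\<lambda>\<omega>. c\<^sup>2 * (Z \<omega>)\<^sup>2 + 2 * c * (Z \<omega> * \<epsilon> \<omega>) + (\<epsilon> \<omega>)\<^sup>2)"
    by (rule arg_cong[where f = expectation]) (auto simp: power2_sum power_mult_distrib algebra_simps)
  also have "\<dots> = c\<^sup>2 * expectation (\<lambda>\<omega>. (Z \<omega>)\<^sup>2) + expectation (\<lambda>\<omega>. (\<epsilon> \<omega>)\<^sup>2)"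
    using Z(2) e(2) cross by simp
  finally show ?thesis
    using e(3) by simp
qed

lemma pmsd_risk_shifted_model:
  fixes X :: "real^'p^'n"
  assumes "prob_space M" and cov: "test_covariate P\<^sub>x \<Sigma> M x\<^sub>0" and noise: "test_noise \<sigma> M x\<^sub>0 \<epsilon>\<^sub>0"
  shows "pmsd_risk lam\<^sub>s (shifted_model lam\<^sub>s \<beta> X M x\<^sub>0 \<epsilon>\<^sub>0 \<eta>) \<xi>
    = (\<xi> - \<eta>)\<^sup>2 * sq_norm_wrt \<Sigma> (pd_gap lam\<^sub>s X \<beta>) + \<sigma>\<^sup>2"
proof -
  interpret prob_space M by fact
  define \<delta> where "\<delta> = pd_gap lam\<^sub>s X \<beta>"
  have mix: "(1 - \<xi>) *\<^sub>R \<beta> + \<xi> *\<^sub>R pd_coeff lam\<^sub>s X \<beta> = \<beta> - \<xi> *\<^sub>R \<delta>"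
    by (simp add: \<delta>_def pd_gap_def algebra_simps)
  have x: "x\<^sub>0 \<in> borel_measurable M" and outer: "integrable M (\<lambda>\<omega>. outer_square (x\<^sub>0 \<omega>))"
    and \<Sigma>: "(\<integral>\<omega>. outer_square (x\<^sub>0 \<omega>) \<partial>M) = \<Sigma>"
    using cov by (auto simp: test_covariate_def)
  have ind: "indep_rvs M borel x\<^sub>0 borel \<epsilon>\<^sub>0" and e: "\<epsilon>\<^sub>0 \<in> borel_measurable M"
    "integrable M (\<lambda>\<omega>. (\<epsilon>\<^sub>0 \<omega>)\<^sup>2)" "expectation \<epsilon>\<^sub>0 = 0" and var: "variance \<epsilon>\<^sub>0 = \<sigma>\<^sup>2"
    using noise by (auto simp: test_noise_def indep_rvs_def)
  have ind': "indep_var borel (\<lambda>\<omega>. x\<^sub>0 \<omega> \<bullet> \<delta>) borel \<epsilon>\<^sub>0"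
    by (rule indep_var_of_indep_rvs[OF ind]) simp
  have Z: "(\<lambda>\<omega>. x\<^sub>0 \<omega> \<bullet> \<delta>) \<in> borel_measurable M"
    using x by simp
  have "pmsd_risk lam\<^sub>s (shifted_model lam\<^sub>s \<beta> X M x\<^sub>0 \<epsilon>\<^sub>0 \<eta>) \<xi>
      = expectation (\<lambda>\<omega>. ((\<xi> - \<eta>) * (x\<^sub>0 \<omega> \<bullet> \<delta>) + \<epsilon>\<^sub>0 \<omega>)\<^sup>2)"
    unfolding pmsd_risk_def shifted_model_def pmsd_predictor_def
    by (simp add: mix \<delta>_def[symmetric] inner_diff_right left_diff_distrib add.commute
        add_diff_eq)
  also have "\<dots> = (\<xi> - \<eta>)\<^sup>2 * expectation (\<lambda>\<omega>. (x\<^sub>0 \<omega> \<bullet> \<delta>)\<^sup>2) + \<sigma>\<^sup>2"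
    using expectation_square_centered_noise[OF Z integrable_inner_square[OF outer] e ind'] var by simp
  finally show ?thesis
    by (simp add: integral_inner_square[OF outer] \<Sigma> \<delta>_def)
qed

lemma
  fixes g :: "real \<Rightarrow> real"
  assumes g: "\<And>\<xi>. g \<xi> = (\<xi> - \<eta>)\<^sup>2 * q + m" and "q > 0"
  shows is_arg_min_parabola_iff: "is_arg_min g (\<lambda>_. True) \<xi> \<longleftrightarrow> \<xi> = \<eta>"
    and arg_min_parabola: "arg_min g (\<lambda>_. True) = \<eta>"
    and Least_range_parabola: "(LEAST r. r \<in> range g) = m"
proof -
  have min: "m \<le> g \<xi>" for \<xi>
    using \<open>q > 0\<close> by (simp add: g)
  have strict: "m < g \<xi>" if "\<xi> \<noteq> \<eta>" for \<xi>
    using \<open>q > 0\<close> that by (simp add: g)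
  have at: "g \<eta> = m"
    by (simp add: g)
  show *: "is_arg_min g (\<lambda>_. True) \<xi> \<longleftrightarrow> \<xi> = \<eta>" for \<xi>
    unfolding is_arg_min_def using min strict at by (metis not_less)
  show "arg_min g (\<lambda>_. True) = \<eta>"
    unfolding arg_min_def * by simp
  show "(LEAST r. r \<in> range g) = m"
    by (rule Least_equality) (use min at in auto)
qed

theorem mainTheorem14:
  fixes \<Sigma> :: "real^'p^'p"
    and lam\<^sub>t lam\<^sub>s \<sigma> :: real
    and \<beta> :: "real^'p"
    and X :: "real^'p^'n"
    and P\<^sub>x :: "(real^'p) measure"
    and M :: "real \<Rightarrow> 'a measure"
    and x\<^sub>0 :: "real \<Rightarrow> 'a \<Rightarrow> real^'p"
    and \<epsilon>\<^sub>0 :: "real \<Rightarrow> 'a \<Rightarrow> real"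
    and E :: "real \<Rightarrow> ('a, 'n, 'p) pmsd_model"
  assumes "positive_definite \<Sigma>"
    and "lam\<^sub>t > 0" and "lam\<^sub>s > 0"
    and "sq_norm_wrt \<Sigma> (pd_gap lam\<^sub>s X \<beta>) > 0"
    and "\<And>\<eta>. prob_space (M \<eta>)"
    and "\<And>\<eta>. test_covariate P\<^sub>x \<Sigma> (M \<eta>) (x\<^sub>0 \<eta>)"
    and "\<And>\<eta>. test_noise \<sigma> (M \<eta>) (x\<^sub>0 \<eta>) (\<epsilon>\<^sub>0 \<eta>)"
    and "\<And>\<eta>. E \<eta> = shifted_model lam\<^sub>s \<beta> X (M \<eta>) (x\<^sub>0 \<eta>) (\<epsilon>\<^sub>0 \<eta>) \<eta>"
  shows "(\<forall>\<eta> \<eta>'. observables (E \<eta>) = observables (E \<eta>'))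
       \<and> (\<forall>\<eta>. second_moment (E \<eta>) = \<Sigma>)
       \<and> (\<forall>\<eta>. (\<forall>\<xi>. is_arg_min (pmsd_risk lam\<^sub>s (E \<eta>)) (\<lambda>_. True) \<xi> \<longleftrightarrow> \<xi> = \<eta>)
             \<and> oracle_weight lam\<^sub>s (E \<eta>) = \<eta>
             \<and> oracle_risk lam\<^sub>s (E \<eta>) = \<sigma>\<^sup>2)
       \<and> \<not> (\<exists>f. \<forall>\<eta>. f (observables (E \<eta>)) = oracle_weight lam\<^sub>s (E \<eta>))
       \<and> \<not> (\<exists>f. \<forall>\<eta>. f (observables (E \<eta>)) (second_moment (E \<eta>)) = oracle_weight lam\<^sub>s (E \<eta>))"
proof -
  have obs: "observables (E \<eta>) = (\<beta>, X)" for \<eta>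
    by (simp add: assms(8) observables_def shifted_model_def)
  have sm: "second_moment (E \<eta>) = \<Sigma>" for \<eta>
    using assms(6)[of \<eta>] by (simp add: assms(8) second_moment_def shifted_model_def test_covariate_def)
  have risk: "pmsd_risk lam\<^sub>s (E \<eta>) \<xi>
      = (\<xi> - \<eta>)\<^sup>2 * sq_norm_wrt \<Sigma> (pd_gap lam\<^sub>s X \<beta>) + \<sigma>\<^sup>2" for \<eta> \<xi>
    unfolding assms(8) by (rule pmsd_risk_shifted_model[OF assms(5-7)])
  have min: "is_arg_min (pmsd_risk lam\<^sub>s (E \<eta>)) (\<lambda>_. True) \<xi> \<longleftrightarrow> \<xi> = \<eta>" for \<eta> \<xi>
    using is_arg_min_parabola_iff[OF risk assms(4)] .
  have weight: "oracle_weight lam\<^sub>s (E \<eta>) = \<eta>" for \<eta>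
    unfolding oracle_weight_def using arg_min_parabola[OF risk assms(4)] .
  have best: "oracle_risk lam\<^sub>s (E \<eta>) = \<sigma>\<^sup>2" for \<eta>
    unfolding oracle_risk_def using Least_range_parabola[OF risk assms(4)] .
  have not_const: "\<not> (\<forall>\<eta>. c = \<eta>)" for c :: real
    using zero_neq_one by metis
  show ?thesis
    by (simp add: obs sm min weight best not_const)
qed

end
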